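(* Let $r$ and $n$ be integers with $r\ge 2$, $n\ge 3$ and $r\le n$, and let $K$ be any field. Then the toric ideal $I_{A_{n,r}}\subset K[\{p(\sigma)\mid \sigma\in S_{n,r}\}]$ of the $(n,r)$-Birkhoff model is generated by binomials, each of degree two or three.
   Context: Write $[m]=\{1,\dots,m\}$. For $1\le r\le n$ let $S_{n,r}=\{\sigma=(\sigma(1),\dots,\sigma(r))\mid \sigma \text{ an injection from } [r] \text{ to } [n]\}$, so $|S_{n,r}|=n!/(n-r)!$. Let $K[\{p(\sigma)\mid\sigma\in S_{n,r}\}]$ be the polynomial ring in indeterminates $p(\sigma)$, $\sigma\in S_{n,r}$, and let $K[\{\psi_{jk}\mid j\in[r],k\in[n]\}]$ be the polynomial ring in indeterminates $\psi_{jk}$. Let $\pi_{n,r}: K[\{p(\sigma)\}]\to K[\{\psi_{jk}\}]$ be the $K$-algebra homomorphism with $\pi_{n,r}(p(\sigma))=\prod_{j=1}^r\psi_{j\,\sigma(j)}$. The toric ideal of the $(n,r)$-Birkhoff model is $I_{A_{n,r}}=\ker\pi_{n,r}$. (Here $A_{n,r}$ is the $rn\times n!/(n-r)!$ zero-one matrix with rows indexed by $(j,k)\in[r]\times[n]$ and columns by $\sigma\in S_{n,r}$, whose $((j,k),\sigma)$ entry is $1$ if and only if $\sigma(j)=k$.) A binomial is a difference of two monomials; its degree is its total degree in the variables $p(\sigma)$. *)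

theory Defs
  imports "HOL-Library.Poly_Mapping" "HOL-Library.FuncSet" "HOL-Algebra.RingHom"
begin

section \<open>Polynomial rings on a set of indeterminates\<close>

text \<open>
  A monomial is a finitely supported exponent function, a polynomial a finitely supported
  function from monomials to coefficients; the type-class product of
  \<^theory>\<open>HOL-Library.Poly_Mapping\<close> is the usual (convolution) product of polynomials.
\<close>

type_synonym 'v mon = "'v \<Rightarrow>\<^sub>0 nat"
type_synonym ('v, 'k) mpol = "'v mon \<Rightarrow>\<^sub>0 'k"

definition mconst :: "'k::field \<Rightarrow> ('v, 'k) mpol" where
  "mconst c = Poly_Mapping.single 0 c"

definition mmon :: "'v mon \<Rightarrow> ('v, 'k::field) mpol" where
  "mmon u = Poly_Mapping.single u 1"

definition mvar :: "'v \<Rightarrow> ('v, 'k::field) mpol" where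
  "mvar x = mmon (Poly_Mapping.single x 1)"

text \<open>The ring \<open>K[x | x \<in> V]\<close>, as a structure in the sense of \<open>HOL-Algebra\<close>.\<close>

definition mpol_ring :: "'v set \<Rightarrow> ('v, 'k::field) mpol ring" where
  "mpol_ring V =
     \<lparr>carrier = {f. \<forall>u\<in>Poly_Mapping.keys f. Poly_Mapping.keys u \<subseteq> V},
      mult = (*), one = 1, zero = 0, add = (+)\<rparr>"

definition mon_degree :: "'v mon \<Rightarrow> nat" where
  "mon_degree u = (\<Sum>x\<in>Poly_Mapping.keys u. Poly_Mapping.lookup u x)"

text \<open>Total degree; the zero polynomial gets degree \<open>0\<close>.\<close>

definition total_degree :: "('v, 'k::field) mpol \<Rightarrow> nat" where
  "total_degree f = Max (insert 0 (mon_degree ` Poly_Mapping.keys f))"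

definition is_binomial :: "('v, 'k::field) mpol \<Rightarrow> bool" where
  "is_binomial f \<longleftrightarrow> (\<exists>u v. f = mmon u - mmon v)"

text \<open>The \<open>K\<close>-algebra homomorphism sending each indeterminate \<open>x\<close> to \<open>\<phi> x\<close>.\<close>

definition mon_subst :: "('v \<Rightarrow> ('w, 'k::field) mpol) \<Rightarrow> 'v mon \<Rightarrow> ('w, 'k) mpol" where
  "mon_subst \<phi> u = (\<Prod>x\<in>Poly_Mapping.keys u. \<phi> x ^ Poly_Mapping.lookup u x)"

definition mpol_subst ::
    "('v \<Rightarrow> ('w, 'k::field) mpol) \<Rightarrow> ('v, 'k) mpol \<Rightarrow> ('w, 'k) mpol" where
  "mpol_subst \<phi> f =
     (\<Sum>u\<in>Poly_Mapping.keys f. mconst (Poly_Mapping.lookup f u) * mon_subst \<phi> u)"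


section \<open>The Birkhoff model\<close>

text \<open>
  Injections from \<open>[r]\<close> to \<open>[n]\<close>; extensionality outside \<open>[r]\<close> makes a function the same
  thing as the word \<open>(\<sigma>(1), \<dots>, \<sigma>(r))\<close>.
\<close>

definition injections :: "nat \<Rightarrow> nat \<Rightarrow> (nat \<Rightarrow> nat) set" where
  "injections n r = {\<sigma> \<in> {1..r} \<rightarrow>\<^sub>E {1..n}. inj_on \<sigma> {1..r}}"

definition birkhoff_source :: "nat \<Rightarrow> nat \<Rightarrow> (nat \<Rightarrow> nat, 'k::field) mpol ring" where
  "birkhoff_source n r = mpol_ring (injections n r)"

definition birkhoff_target :: "nat \<Rightarrow> nat \<Rightarrow> (nat \<times> nat, 'k::field) mpol ring" where
  "birkhoff_target n r = mpol_ring ({1..r} \<times> {1..n})"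

definition birkhoff_map ::
    "nat \<Rightarrow> (nat \<Rightarrow> nat, 'k::field) mpol \<Rightarrow> (nat \<times> nat, 'k) mpol" where
  "birkhoff_map r = mpol_subst (\<lambda>\<sigma>. \<Prod>j\<in>{1..r}. mvar (j, \<sigma> j))"

definition birkhoff_toric_ideal :: "nat \<Rightarrow> nat \<Rightarrow> (nat \<Rightarrow> nat, 'k::field) mpol set" where
  "birkhoff_toric_ideal n r =
     a_kernel (birkhoff_source n r) (birkhoff_target n r) (birkhoff_map r)"


section \<open>The structures above are what they should be\<close>

lemma mpol_ring_simps:
  "carrier (mpol_ring V) = {f. \<forall>u\<in>Poly_Mapping.keys f. Poly_Mapping.keys u \<subseteq> V}"
  "f \<otimes>\<^bsub>mpol_ring V\<^esub> g = f * g" "f \<oplus>\<^bsub>mpol_ring V\<^esub> g = f + g"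
  "\<one>\<^bsub>mpol_ring V\<^esub> = 1" "\<zero>\<^bsub>mpol_ring V\<^esub> = 0"
  by (simp_all add: mpol_ring_def)

lemma add_in_mpol_ring:
  assumes "f \<in> carrier (mpol_ring V)" "g \<in> carrier (mpol_ring V)"
  shows "f + g \<in> carrier (mpol_ring V)"
  using assms Poly_Mapping.keys_add[of f g] by (fastforce simp: mpol_ring_simps)

lemma mult_in_mpol_ring:
  assumes "f \<in> carrier (mpol_ring V)" "g \<in> carrier (mpol_ring V)"
  shows "f * g \<in> carrier (mpol_ring V)"
proof -
  have "Poly_Mapping.keys u \<subseteq> V" if u: "u \<in> Poly_Mapping.keys (f * g)" for u
  proof -
    obtain a b where "u = a + b" "a \<in> Poly_Mapping.keys f" "b \<in> Poly_Mapping.keys g"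
      using subsetD[OF keys_mult u] by auto
    then show ?thesis
      using assms Poly_Mapping.keys_add[of a b] by (fastforce simp: mpol_ring_simps)
  qed
  then show ?thesis by (simp add: mpol_ring_simps)
qed

lemma mconst_in_mpol_ring: "mconst c \<in> carrier (mpol_ring V)"
  by (simp add: mpol_ring_simps mconst_def)

lemma one_in_mpol_ring: "1 \<in> carrier (mpol_ring V)"
  using mconst_in_mpol_ring[of 1] by (simp add: mconst_def)

lemma zero_in_mpol_ring: "0 \<in> carrier (mpol_ring V)"
  by (simp add: mpol_ring_simps)

lemma mvar_in_mpol_ring: "x \<in> V \<Longrightarrow> mvar x \<in> carrier (mpol_ring V)"
  by (simp add: mpol_ring_simps mvar_def mmon_def)

lemma prod_in_mpol_ring:
  "(\<And>x. x \<in> A \<Longrightarrow> f x \<in> carrier (mpol_ring V)) \<Longrightarrow> prod f A \<in> carrier (mpol_ring V)"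
  by (induction A rule: infinite_finite_induct) (auto intro: one_in_mpol_ring mult_in_mpol_ring)

lemma sum_in_mpol_ring:
  "(\<And>x. x \<in> A \<Longrightarrow> f x \<in> carrier (mpol_ring V)) \<Longrightarrow> sum f A \<in> carrier (mpol_ring V)"
  by (induction A rule: infinite_finite_induct)
    (simp_all add: add_in_mpol_ring zero_in_mpol_ring)

lemma power_in_mpol_ring:
  "f \<in> carrier (mpol_ring V) \<Longrightarrow> f ^ k \<in> carrier (mpol_ring V)"
  by (induction k) (auto intro: one_in_mpol_ring mult_in_mpol_ring)

lemma cring_mpol_ring: "cring (mpol_ring V :: ('v, 'k::field) mpol ring)"
proof (intro cringI abelian_groupI comm_monoidI)
  fix f :: "('v, 'k::field) mpol"
  assume "f \<in> carrier (mpol_ring V)"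
  then have "- f \<in> carrier (mpol_ring V)" "- f + f = 0"
    by (auto simp: mpol_ring_simps)
  then show "\<exists>g\<in>carrier (mpol_ring V). g \<oplus>\<^bsub>mpol_ring V\<^esub> f = \<zero>\<^bsub>mpol_ring V\<^esub>"
    unfolding mpol_ring_simps(2-) by blast
qed (simp_all add: mpol_ring_simps(2-) add_in_mpol_ring mult_in_mpol_ring one_in_mpol_ring
       zero_in_mpol_ring algebra_simps)

lemma mon_subst_superset:
  assumes "finite A" "Poly_Mapping.keys u \<subseteq> A"
  shows "mon_subst \<phi> u = (\<Prod>x\<in>A. \<phi> x ^ Poly_Mapping.lookup u x)"
  unfolding mon_subst_def using assms
  by (intro prod.mono_neutral_left) (auto simp: in_keys_iff)

lemma mon_subst_add: "mon_subst \<phi> (u + v) = mon_subst \<phi> u * mon_subst \<phi> v"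
proof -
  define A where "A = Poly_Mapping.keys u \<union> Poly_Mapping.keys v"
  have "finite A" "Poly_Mapping.keys u \<subseteq> A" "Poly_Mapping.keys v \<subseteq> A"
       "Poly_Mapping.keys (u + v) \<subseteq> A"
    using Poly_Mapping.keys_add[of u v] by (auto simp: A_def)
  then show ?thesis
    by (simp add: mon_subst_superset lookup_add power_add prod.distrib)
qed

lemma mpol_subst_add: "mpol_subst \<phi> (f + g) = mpol_subst \<phi> f + mpol_subst \<phi> g"
  unfolding mpol_subst_def
  by (rule setsum_keys_plus_distrib[where f = "\<lambda>u c. mconst c * mon_subst \<phi> u"])
    (simp_all add: mconst_def single_add distrib_right)

lemma mpol_subst_zero: "mpol_subst \<phi> 0 = 0"
  by (simp add: mpol_subst_def)

lemma mpol_subst_single: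
  "mpol_subst \<phi> (Poly_Mapping.single u c) = mconst c * mon_subst \<phi> u"
  by (simp add: mpol_subst_def mconst_def)

lemma mpol_decomp:
  "f = (\<Sum>u\<in>Poly_Mapping.keys f. Poly_Mapping.single u (Poly_Mapping.lookup f u))"
  by (rule poly_mapping_eqI)
    (auto simp: lookup_sum lookup_single when_def sum.delta in_keys_iff)

lemma mpol_subst_sum: "mpol_subst \<phi> (sum f A) = (\<Sum>x\<in>A. mpol_subst \<phi> (f x))"
  by (induction A rule: infinite_finite_induct)
    (simp_all add: mpol_subst_add mpol_subst_zero)

lemma mpol_subst_mult: "mpol_subst \<phi> (f * g) = mpol_subst \<phi> f * mpol_subst \<phi> g"
proof -
  let ?s = "\<lambda>f u. Poly_Mapping.single u (Poly_Mapping.lookup f u)"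
  have *: "mpol_subst \<phi> (?s f u * ?s g v) = mpol_subst \<phi> (?s f u) * mpol_subst \<phi> (?s g v)" for u v
    by (simp add: mult_single mpol_subst_single mon_subst_add mconst_def)
      (metis (no_types, lifting) add_0 mult.assoc mult.left_commute mult_single)
  have "mpol_subst \<phi> (f * g) =
      mpol_subst \<phi> ((\<Sum>u\<in>Poly_Mapping.keys f. ?s f u) * (\<Sum>v\<in>Poly_Mapping.keys g. ?s g v))"
    by (simp flip: mpol_decomp)
  also have "\<dots> = mpol_subst \<phi> (\<Sum>u\<in>Poly_Mapping.keys f. ?s f u)
      * mpol_subst \<phi> (\<Sum>v\<in>Poly_Mapping.keys g. ?s g v)"
    by (simp only: sum_product mpol_subst_sum *)
  finally show ?thesis by (simp flip: mpol_decomp)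
qed

lemma mpol_subst_mconst: "mpol_subst \<phi> (mconst c) = mconst c"
  by (simp add: mconst_def mpol_subst_single mon_subst_def)

lemma mpol_subst_mvar: "mpol_subst \<phi> (mvar x) = \<phi> x"
  by (simp add: mvar_def mmon_def mpol_subst_single mon_subst_def mconst_def)

lemma birkhoff_map_mconst: "birkhoff_map r (mconst c) = mconst c"
  by (simp add: birkhoff_map_def mpol_subst_mconst)

lemma birkhoff_map_mvar: "birkhoff_map r (mvar \<sigma>) = (\<Prod>j\<in>{1..r}. mvar (j, \<sigma> j))"
  by (simp add: birkhoff_map_def mpol_subst_mvar)

lemma birkhoff_map_hom:
  "birkhoff_map r \<in> ring_hom (birkhoff_source n r) (birkhoff_target n r)"
proof (rule ring_hom_memI)
  fix f :: "(nat \<Rightarrow> nat, 'k::field) mpol"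
  assume f: "f \<in> carrier (birkhoff_source n r)"
  have img: "(\<Prod>j\<in>{1..r}. mvar (j, \<sigma> j)) \<in> carrier (mpol_ring ({1..r} \<times> {1..n}))"
    if "\<sigma> \<in> injections n r" for \<sigma>
    using that by (intro prod_in_mpol_ring mvar_in_mpol_ring) (auto simp: injections_def)
  show "birkhoff_map r f \<in> carrier (birkhoff_target n r)"
    unfolding birkhoff_map_def birkhoff_target_def mpol_subst_def mon_subst_def
    using f
    by (intro sum_in_mpol_ring mult_in_mpol_ring mconst_in_mpol_ring prod_in_mpol_ring
          power_in_mpol_ring img)
      (auto simp: birkhoff_source_def mpol_ring_simps(1))
next
  show "birkhoff_map r \<one>\<^bsub>birkhoff_source n r\<^esub> = \<one>\<^bsub>birkhoff_target n r\<^esub>"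
    using birkhoff_map_mconst[of r 1]
    by (simp add: birkhoff_source_def birkhoff_target_def mpol_ring_simps mconst_def)
qed (simp_all add: birkhoff_source_def birkhoff_target_def birkhoff_map_def mpol_ring_simps(2-)
       mpol_subst_mult mpol_subst_add)

end

(*
  As the kernel of a monomial map, the toric ideal is spanned by the binomials of pairs of monomials
  with equal image, that is, of pairs F, H of multisets of injections with the same marginals. So it
  suffices to turn F into H by replacing two or three injections at a time, keeping the marginals.
  By induction on the size it suffices to make one given member M of H appear in F.

  Take p, q in F and a word P with the right content, starting from P = p, such that P y is p y or
  q y at every position y but one. Exchange two values of P so that it agrees with M in a further
  position z. If the new value at z comes from neither p nor q, then it comes from a third word c of
  F, and Hall's theorem splits the letters of p, q, c into three words such that the new P is again
  covered, except in one position, by two of them. So each step is an exchange of three words. Once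
  P = M, the missing value is supplied by one more word, and M is split off.
*)

theory Submission
  imports Defs "HOL-Library.Multiset"
begin

section \<open>Transversals with prescribed content\<close>

text \<open>Hall's theorem with capacities, by the Halmos-Vaughan induction on
  \<open>card Y\<close>: either some proper nonempty set of positions is tight and the problem
  splits there, or all such sets have slack and one position can be filled with any available
  letter.\<close>

lemma hall_capacities:
  fixes N :: "'y \<Rightarrow> 'c set" and k :: "'c \<Rightarrow> nat"
  assumes "finite Y" "\<And>y. y \<in> Y \<Longrightarrow> finite (N y)"
    and "\<And>S. S \<subseteq> Y \<Longrightarrow> card S \<le> (\<Sum>c\<in>\<Union>(N ` S). k c)"
  shows "\<exists>u. (\<forall>y\<in>Y. u y \<in> N y) \<and> (\<forall>c. card {y \<in> Y. u y = c} \<le> k c)"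
  using assms
proof (induction "card Y" arbitrary: Y k rule: less_induct)
  case less
  have fU: "finite (\<Union>(N ` S))" if "S \<subseteq> Y" for S
    using that less.prems(1,2) by (meson finite_UN finite_subset subsetD)
  show ?case
  proof (cases "\<exists>S. S \<subseteq> Y \<and> S \<noteq> {} \<and> S \<noteq> Y \<and> card S = (\<Sum>c\<in>\<Union>(N ` S). k c)")
    case True
    then obtain S where S: "S \<subseteq> Y" "S \<noteq> {}" "S \<noteq> Y" "card S = (\<Sum>c\<in>\<Union>(N ` S). k c)"
      by blast
    have fS: "finite S" using S less.prems(1) finite_subset by blast
    have "card S < card Y" by (rule psubset_card_mono) (use S less.prems(1) in auto)
    moreover have "card T \<le> (\<Sum>c\<in>\<Union>(N ` T). k c)" if "T \<subseteq> S" for T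
      using less.prems(3)[of T] that S(1) by blast
    ultimately obtain u where u: "\<forall>y\<in>S. u y \<in> N y" "\<forall>c. card {y \<in> S. u y = c} \<le> k c"
      using less.hyps[of S k] less.prems(2) S(1) fS by blast
    \<comment> \<open>Since \<open>S\<close> is tight, filling it consumes the whole capacity of its
      letters, so they count as exhausted for \<open>Y - S\<close>.\<close>
    define k' where "k' c = (if c \<in> \<Union>(N ` S) then 0 else k c)" for c
    have lt: "card (Y - S) < card Y"
      by (rule psubset_card_mono) (use S less.prems(1) in auto)
    have cond: "card T \<le> (\<Sum>c\<in>\<Union>(N ` T). k' c)" if T: "T \<subseteq> Y - S" for T
    proof -
      have fT: "finite T" using T less.prems(1) finite_subset by blast
      have "card S + card T = card (S \<union> T)"
        using T fS fT by (subst card_Un_disjoint) auto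
      also have "\<dots> \<le> (\<Sum>c\<in>\<Union>(N ` (S \<union> T)). k c)"
        using less.prems(3)[of "S \<union> T"] S T by blast
      also have "\<Union>(N ` (S \<union> T)) = \<Union>(N ` S) \<union> (\<Union>(N ` T) - \<Union>(N ` S))" by auto
      also have "(\<Sum>c\<in>\<dots>. k c) = (\<Sum>c\<in>\<Union>(N ` S). k c) + (\<Sum>c\<in>\<Union>(N ` T) - \<Union>(N ` S). k c)"
        using fU[of S] fU[of T] S T by (intro sum.union_disjoint) auto
      also have "(\<Sum>c\<in>\<Union>(N ` T) - \<Union>(N ` S). k c) = (\<Sum>c\<in>\<Union>(N ` T). k' c)"
        using fU[of T] T by (intro sum.mono_neutral_cong_left) (auto simp: k'_def)
      finally show ?thesis using S(4) by simp
    qed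
    obtain v where v: "\<forall>y\<in>Y - S. v y \<in> N y" "\<forall>c. card {y \<in> Y - S. v y = c} \<le> k' c"
      using less.hyps[OF lt _ _ cond] less.prems(1,2) by blast
    define w where "w y = (if y \<in> S then u y else v y)" for y
    have "card {y \<in> Y. w y = c} \<le> k c" for c
    proof (cases "c \<in> \<Union>(N ` S)")
      case True
      have "card {y \<in> Y - S. v y = c} = 0" using v(2)[rule_format, of c] True by (simp add: k'_def)
      then have "{y \<in> Y - S. v y = c} = {}" using less.prems(1) by simp
      then have "{y \<in> Y. w y = c} = {y \<in> S. u y = c}" using S by (auto simp: w_def)
      then show ?thesis using u by simp
    next
      case False
      then have "{y \<in> Y. w y = c} = {y \<in> Y - S. v y = c}" using S u by (auto simp: w_def)
      then show ?thesis using v(2)[rule_format, of c] False by (simp add: k'_def)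
    qed
    moreover have "\<forall>y\<in>Y. w y \<in> N y" using u v by (auto simp: w_def)
    ultimately show ?thesis by blast
  next
    case slack: False
    show ?thesis
    proof (cases "Y = {}")
      case False
      then obtain y where y: "y \<in> Y" by blast
      have "1 \<le> (\<Sum>c\<in>N y. k c)" using less.prems(3)[of "{y}"] y by simp
      then obtain c where c: "c \<in> N y" "k c > 0"
        by (metis not_gr_zero not_one_le_zero sum.neutral)
      define k' where "k' = k(c := k c - 1)"
      have lt: "card (Y - {y}) < card Y" using y less.prems(1) by (metis card_Diff1_less)
      \<comment> \<open>Without tight sets Hall's inequality is strict, which pays for the unit of
        capacity of \<open>c\<close> spent at \<open>y\<close>.\<close>
      have cond: "card S \<le> (\<Sum>c\<in>\<Union>(N ` S). k' c)" if S: "S \<subseteq> Y - {y}" for S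
      proof (cases "S = {}")
        case False
        have "S \<subseteq> Y" "S \<noteq> Y" using S y by auto
        then have "card S < (\<Sum>c\<in>\<Union>(N ` S). k c)"
          using slack False less.prems(3)[of S] by (metis le_neq_implies_less)
        also have "\<dots> \<le> (\<Sum>d\<in>\<Union>(N ` S). k' d + (if d = c then 1 else 0))"
          by (intro sum_mono) (auto simp: k'_def)
        also have "\<dots> \<le> (\<Sum>d\<in>\<Union>(N ` S). k' d) + 1"
          using fU[of S] \<open>S \<subseteq> Y\<close> by (simp add: sum.distrib)
        finally show ?thesis by simp
      qed simp
      obtain u where u: "\<forall>z\<in>Y - {y}. u z \<in> N z" "\<forall>c. card {z \<in> Y - {y}. u z = c} \<le> k' c"
        using less.hyps[OF lt _ _ cond] less.prems(1,2) by blast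
      define w where "w = u(y := c)"
      have "card {z \<in> Y. w z = d} \<le> k d" for d
      proof (cases "d = c")
        case True
        then have "{z \<in> Y. w z = d} = insert y {z \<in> Y - {y}. u z = d}"
          using y by (auto simp: w_def)
        then have "card {z \<in> Y. w z = d} = Suc (card {z \<in> Y - {y}. u z = d})"
          using less.prems(1) by simp
        then show ?thesis using u(2)[rule_format, of d] True c by (simp add: k'_def)
      next
        case False
        then have "{z \<in> Y. w z = d} = {z \<in> Y - {y}. u z = d}" by (auto simp: w_def)
        then show ?thesis using u(2)[rule_format, of d] False by (simp add: k'_def)
      qed
      moreover have "\<forall>y\<in>Y. w y \<in> N y" using u c by (auto simp: w_def)
      ultimately show ?thesis by blast
    qed simp
  qed
qed

section \<open>Words as transversals of regular bipartite multigraphs\<close>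

definition words :: "'y set \<Rightarrow> ('c \<Rightarrow> nat) \<Rightarrow> ('y \<Rightarrow> 'c) set" where
  "words Y k = {w \<in> extensional Y. \<forall>c. card {y \<in> Y. w y = c} = k c}"

text \<open>\<open>D\<close> is read as a bipartite multigraph from positions to letters: each
  position has degree \<open>m\<close>, each letter \<open>c\<close> has degree
  \<open>m * k c\<close>. Superposing \<open>m\<close> words gives such a graph; the lemmas below
  decompose it into words again.\<close>

definition regular :: "'y set \<Rightarrow> ('c \<Rightarrow> nat) \<Rightarrow> nat \<Rightarrow> ('y \<Rightarrow> 'c multiset) \<Rightarrow> bool" where
  "regular Y k m D \<longleftrightarrow>
     (\<forall>y\<in>Y. size (D y) = m) \<and> (\<forall>c. (\<Sum>y\<in>Y. count (D y) c) = m * k c)"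

lemma words_eqI:
  assumes "v \<in> words Y k" "w \<in> words Y k" "\<And>y. y \<in> Y \<Longrightarrow> v y = w y"
  shows "v = w"
  using assms by (auto simp: words_def intro: extensionalityI)

text \<open>The counts of \<open>u\<close> and the numbers \<open>k c\<close> both add up to
  \<open>card Y\<close>, so no inequality can be strict. The word \<open>p\<close> certifies the sum
  of \<open>k\<close>.\<close>

lemma words_countI:
  assumes Y: "finite Y" and p: "p \<in> words Y k" and le: "\<And>c. card {y \<in> Y. u y = c} \<le> k c"
  shows "restrict u Y \<in> words Y k"
proof -
  have *: "(\<Sum>c\<in>p ` Y \<union> u ` Y. card {y \<in> Y. w y = c}) = card Y" if "w \<in> {p, u}" for w
  proof -
    have "card Y = (\<Sum>c\<in>w ` Y. card {y \<in> Y. w y = c})"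
      using sum.image_gen[OF Y, of "\<lambda>_. 1::nat" w] by (simp only: card_eq_sum)
    also have "\<dots> = (\<Sum>c\<in>p ` Y \<union> u ` Y. card {y \<in> Y. w y = c})"
      using Y that by (intro sum.mono_neutral_left) auto
    finally show ?thesis by simp
  qed
  have k: "card {y \<in> Y. p y = c} = k c" for c using p by (simp add: words_def)
  have "card {y \<in> Y. u y = c} = k c" for c
  proof (cases "c \<in> p ` Y \<union> u ` Y")
    case True
    have "(\<Sum>c\<in>p ` Y \<union> u ` Y. card {y \<in> Y. u y = c}) = (\<Sum>c\<in>p ` Y \<union> u ` Y. k c)"
      using *[of p] *[of u] k by simp
    from sum_mono_inv[OF this _ True] le Y show ?thesis by blast
  next
    case False
    then have "{y \<in> Y. u y = c} = {}" "{y \<in> Y. p y = c} = {}" by auto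
    then show ?thesis using k by metis
  qed
  moreover have "{y \<in> Y. restrict u Y y = c} = {y \<in> Y. u y = c}" for c by auto
  ultimately show ?thesis by (simp add: words_def)
qed

text \<open>The letter \<open>a\<close> may occur once too often: in Hall's condition this surplus is lost by parity.\<close>

lemma transversal_word:
  assumes Y: "finite Y" and p: "p \<in> words Y k" and size: "\<And>y. y \<in> Y \<Longrightarrow> 2 \<le> size (E y)"
    and deg: "\<And>c. (\<Sum>y\<in>Y. count (E y) c) \<le> 2 * k c + (if c = a then 1 else 0)"
  shows "\<exists>u\<in>words Y k. \<forall>y\<in>Y. u y \<in># E y"
proof -
  have "card S \<le> (\<Sum>c\<in>(\<Union>y\<in>S. set_mset (E y)). k c)" (is "_ \<le> sum k ?N") if S: "S \<subseteq> Y" for S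
  proof -
    have fS: "finite S" using S Y finite_subset by blast
    \<comment> \<open>Double counting of the edges between \<open>S\<close> and the letters
      available there.\<close>
    have "2 * card S \<le> (\<Sum>y\<in>S. size (E y))"
      using size S sum_bounded_below[of S 2 "\<lambda>y. size (E y)"] by (auto simp: mult.commute)
    also have "\<dots> = (\<Sum>y\<in>S. \<Sum>c\<in>?N. count (E y) c)"
      using fS by (intro sum.cong refl, unfold size_multiset_overloaded_eq)
        (rule sum.mono_neutral_left, auto simp: not_in_iff)
    also have "\<dots> = (\<Sum>c\<in>?N. \<Sum>y\<in>S. count (E y) c)" by (rule sum.swap)
    also have "\<dots> \<le> (\<Sum>c\<in>?N. 2 * k c + (if c = a then 1 else 0))"
      by (intro sum_mono order_trans[OF _ deg] sum_mono2) (use S Y in auto)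
    also have "\<dots> \<le> 2 * sum k ?N + 1"
      using fS by (simp add: sum.distrib sum_distrib_left)
    finally show ?thesis by simp
  qed
  then obtain u where u: "\<forall>y\<in>Y. u y \<in> set_mset (E y)" "\<forall>c. card {y \<in> Y. u y = c} \<le> k c"
    using hall_capacities[of Y "\<lambda>y. set_mset (E y)" k] Y by auto
  then show ?thesis using words_countI[OF Y p, of u] by (intro bexI[of _ "restrict u Y"]) auto
qed

lemma sum_count_word:
  assumes "finite Y" "w \<in> words Y k"
  shows "(\<Sum>y\<in>Y. count {#w y#} c) = k c"
proof -
  have "(\<Sum>y\<in>Y. count {#w y#} c) = (\<Sum>y\<in>Y. if w y = c then 1 else 0)"
    by (intro sum.cong) auto
  also have "\<dots> = card {y \<in> Y. w y = c}"
    using assms(1) by (simp add: sum.If_cases Int_def)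
  finally show ?thesis using assms(2) by (simp add: words_def)
qed

lemma regular_word: "finite Y \<Longrightarrow> w \<in> words Y k \<Longrightarrow> regular Y k 1 (\<lambda>y. {#w y#})"
  unfolding regular_def using sum_count_word[of Y w k] by (simp del: count_add_mset)

lemma regular_add:
  "regular Y k m D \<Longrightarrow> regular Y k l E \<Longrightarrow> regular Y k (m + l) (\<lambda>y. D y + E y)"
  by (simp add: regular_def sum.distrib algebra_simps)

lemma regular_remove:
  assumes "finite Y" "regular Y k l D" "l = Suc m" "w \<in> words Y k" "\<And>y. y \<in> Y \<Longrightarrow> w y \<in># D y"
  shows "regular Y k m (\<lambda>y. D y - {#w y#})"
proof -
  have "(\<Sum>y\<in>Y. count (D y - {#w y#}) c) + k c = Suc m * k c" for c
  proof -
    have "(\<Sum>y\<in>Y. count (D y - {#w y#}) c) + (\<Sum>y\<in>Y. count {#w y#} c) = (\<Sum>y\<in>Y. count (D y) c)"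
      unfolding sum.distrib[symmetric] count_union[symmetric]
      using assms(5) by (intro sum.cong) auto
    then show ?thesis using sum_count_word[OF assms(1,4)] assms(2,3) by (simp add: regular_def del: count_add_mset)
  qed
  then show ?thesis using assms(2,3,5) by (auto simp: regular_def size_Diff_singleton)
qed

lemma regular_1_word:
  assumes Y: "finite Y" and D: "regular Y k 1 D"
  shows "\<exists>w\<in>words Y k. \<forall>y\<in>Y. D y = {#w y#}"
proof -
  have "\<forall>y\<in>Y. \<exists>c. D y = {#c#}" using D by (simp add: regular_def size_1_singleton_mset)
  then obtain w where w: "\<forall>y\<in>Y. D y = {#w y#}" by metis
  have "card {y \<in> Y. w y = c} = k c" for c
  proof -
    have "card {y \<in> Y. w y = c} = (\<Sum>y\<in>Y. if w y = c then 1 else 0)"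
      using Y by (simp add: sum.If_cases Int_def)
    also have "\<dots> = (\<Sum>y\<in>Y. count (D y) c)" using w by (intro sum.cong) auto
    finally show ?thesis using D by (simp add: regular_def)
  qed
  moreover have "{y \<in> Y. restrict w Y y = c} = {y \<in> Y. w y = c}" for c by auto
  ultimately show ?thesis using w by (intro bexI[of _ "restrict w Y"]) (auto simp: words_def)
qed

text \<open>Hall's theorem extracts one word, and the 1-regular rest is a word too.\<close>

lemma regular_2_words:
  assumes Y: "finite Y" and D: "regular Y k 2 D" and p: "p \<in> words Y k"
  shows "\<exists>u\<in>words Y k. \<exists>v\<in>words Y k. \<forall>y\<in>Y. D y = {#u y, v y#}"
proof -
  obtain u where u: "u \<in> words Y k" "\<forall>y\<in>Y. u y \<in># D y"
    using transversal_word[OF Y p, of D] D by (auto simp: regular_def)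
  have "regular Y k 1 (\<lambda>y. D y - {#u y#})"
    by (rule regular_remove[OF Y D _ u(1)]) (use u(2) in auto)
  then obtain v where v: "v \<in> words Y k" "\<forall>y\<in>Y. D y - {#u y#} = {#v y#}"
    using regular_1_word[OF Y] by blast
  have "\<forall>y\<in>Y. D y = {#u y, v y#}" using u v by (metis insert_DiffM)
  then show ?thesis using u v by blast
qed

text \<open>The surplus letter arises as \<open>P z\<close>, when \<open>P\<close> is withheld from \<open>D\<close> everywhere but at \<open>z\<close>, where
  \<open>D\<close> need not contain it.\<close>

lemma regular_3_words:
  assumes Y: "finite Y" and D: "regular Y k 3 D" and P: "P \<in> words Y k" and z: "z \<in> Y"
    and PD: "\<And>y. y \<in> Y - {z} \<Longrightarrow> P y \<in># D y"
  shows "\<exists>p\<in>words Y k. \<exists>q\<in>words Y k. \<exists>u\<in>words Y k.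
    (\<forall>y\<in>Y. D y = {#p y, q y, u y#}) \<and> (\<forall>y\<in>Y - {z}. P y \<in> {p y, q y})"
proof -
  define E where "E y = (if y = z then D y else D y - {#P y#})" for y
  have "\<exists>u\<in>words Y k. \<forall>y\<in>Y. u y \<in># E y"
  proof (rule transversal_word[OF Y P])
    show "2 \<le> size (E y)" if "y \<in> Y" for y
      using D PD that by (auto simp: E_def regular_def size_Diff_singleton)
    show "(\<Sum>y\<in>Y. count (E y) c) \<le> 2 * k c + (if c = P z then 1 else 0)" for c
    proof -
      have "(\<Sum>y\<in>Y. count (E y) c) + (\<Sum>y\<in>Y. count {#P y#} c)
          = (\<Sum>y\<in>Y. count (D y) c + (if y = z then count {#P z#} c else 0))"
        unfolding sum.distrib[symmetric]
      proof (rule sum.cong)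
        fix y assume "y \<in> Y"
        then show "count (E y) c + count {#P y#} c = count (D y) c + (if y = z then count {#P z#} c else 0)"
          using PD[of y] by (cases "y = z") (auto simp: E_def simp flip: count_union)
      qed simp
      also have "\<dots> = 3 * k c + (if c = P z then 1 else 0)"
        using D z Y by (auto simp: sum.distrib regular_def)
      finally show ?thesis using sum_count_word[OF Y P] by simp
    qed
  qed
  then obtain u where u: "u \<in> words Y k" "\<forall>y\<in>Y. u y \<in># E y" by blast
  have uD: "u y \<in># D y" if "y \<in> Y" for y
    using u(2)[rule_format, OF that] by (auto simp: E_def split: if_splits dest: in_diffD)
  then have "regular Y k 2 (\<lambda>y. D y - {#u y#})"
    by (intro regular_remove[OF Y D _ u(1)]) auto
  then obtain p q where pq: "p \<in> words Y k" "q \<in> words Y k" "\<forall>y\<in>Y. D y - {#u y#} = {#p y, q y#}"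
    using regular_2_words[OF Y _ P] by blast
  have "\<forall>y\<in>Y. D y = {#p y, q y, u y#}" using uD pq(3)
    by (metis insert_DiffM add_mset_commute)
  \<comment> \<open>Off \<open>z\<close>, the letter \<open>u y\<close> was chosen after one copy of
    \<open>P y\<close> had been set aside, so that copy survives the removal of
    \<open>u y\<close>.\<close>
  moreover have "P y \<in> {p y, q y}" if y: "y \<in> Y - {z}" for y
  proof -
    have "D y = add_mset (P y) (E y)" using PD[OF y] y by (auto simp: E_def)
    moreover have "E y = add_mset (u y) (E y - {#u y#})" using u(2) y by simp
    ultimately have "D y - {#u y#} = add_mset (P y) (E y - {#u y#})"
      by (metis add_mset_commute add_mset_remove_trivial)
    then have "P y \<in># {#p y, q y#}" using pq(3) y by (metis DiffD1 union_single_eq_member)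
    then show ?thesis by simp
  qed
  ultimately show ?thesis using pq u by blast
qed

section \<open>Connectivity by exchanges of two or three words\<close>

text \<open>The combinatorial form of a monomial multiple of a quadratic or cubic binomial, with
  \<open>W\<close> as the cofactor. The trivial exchange \<open>A = B\<close> is allowed.\<close>

inductive exchange :: "'y set \<Rightarrow> ('c \<Rightarrow> nat) \<Rightarrow> ('y \<Rightarrow> 'c) multiset \<Rightarrow> ('y \<Rightarrow> 'c) multiset \<Rightarrow> bool"
  for Y k where
  "exchange Y k (A + W) (B + W)"
  if "set_mset (A + B + W) \<subseteq> words Y k" "size A = 2 \<or> size A = 3" "size B = size A"
    "\<And>y. y \<in> Y \<Longrightarrow> image_mset (\<lambda>w. w y) A = image_mset (\<lambda>w. w y) B"

lemma exchange_words: "exchange Y k F H \<Longrightarrow> set_mset F \<subseteq> words Y k \<and> set_mset H \<subseteq> words Y k"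
  by (auto elim!: exchange.cases)

lemma exchange_marginal:
  "exchange Y k F H \<Longrightarrow> y \<in> Y \<Longrightarrow> image_mset (\<lambda>w. w y) F = image_mset (\<lambda>w. w y) H"
  by (auto elim!: exchange.cases)

lemma exchange_size: "exchange Y k F H \<Longrightarrow> size F = size H"
  by (auto elim!: exchange.cases)

text \<open>Membership in \<open>words\<close> appears as an equivalence because an empty chain says
  nothing about it.\<close>

lemma exchanges_invariants:
  assumes "(exchange Y k)\<^sup>*\<^sup>* F H"
  shows "(set_mset F \<subseteq> words Y k \<longleftrightarrow> set_mset H \<subseteq> words Y k) \<and> size F = size H \<and>
    (\<forall>y\<in>Y. image_mset (\<lambda>w. w y) F = image_mset (\<lambda>w. w y) H)"
  using assms
proof (induction rule: rtranclp_induct)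
  case (step H J)
  have "set_mset H \<subseteq> words Y k" "set_mset J \<subseteq> words Y k" "size H = size J"
    "\<forall>y\<in>Y. image_mset (\<lambda>w. w y) H = image_mset (\<lambda>w. w y) J"
    using exchange_words[OF step(2)] exchange_marginal[OF step(2)] exchange_size[OF step(2)] by auto
  then show ?case using step.IH by simp
qed simp

lemma exchange_add_mset:
  assumes "exchange Y k F H" "w \<in> words Y k"
  shows "exchange Y k (add_mset w F) (add_mset w H)"
  using assms(1)
proof cases
  case (1 A B W)
  then show ?thesis using exchange.intros[of A B "add_mset w W" Y k] assms(2) by simp
qed

lemma exchanges_add_mset:
  assumes "(exchange Y k)\<^sup>*\<^sup>* F H" "w \<in> words Y k"
  shows "(exchange Y k)\<^sup>*\<^sup>* (add_mset w F) (add_mset w H)"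
  using assms(1)
  by (induction rule: rtranclp_induct) (auto intro: rtranclp.rtrancl_into_rtrancl exchange_add_mset[OF _ assms(2)])

section \<open>Splitting off a word covered by two or three others\<close>

text \<open>Taking \<open>P\<close> away from two superposed words leaves a 1-regular graph, which
  is the word \<open>q'\<close>.\<close>

lemma exchange_extract_2:
  assumes Y: "finite Y" and F: "set_mset (add_mset p (add_mset q W)) \<subseteq> words Y k"
    and P: "P \<in> words Y k" "\<And>y. y \<in> Y \<Longrightarrow> P y \<in> {p y, q y}"
  shows "\<exists>q'. exchange Y k (add_mset p (add_mset q W)) (add_mset P (add_mset q' W))"
proof -
  have "regular Y k 2 (\<lambda>y. {#p y, q y#})"
    using regular_add[OF regular_word[OF Y, of q k] regular_word[OF Y, of p k]] F
    by (simp add: numeral_2_eq_2)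
  then have "regular Y k 1 (\<lambda>y. {#p y, q y#} - {#P y#})"
    by (rule regular_remove[OF Y _ _ P(1)]) (use P(2) in auto)
  then obtain v where v: "v \<in> words Y k" "\<forall>y\<in>Y. {#p y, q y#} - {#P y#} = {#v y#}"
    using regular_1_word[OF Y] by blast
  have "\<forall>y\<in>Y. {#p y, q y#} = {#P y, v y#}"
    using v(2) P(2) by (metis insert_DiffM insert_iff set_mset_add_mset_insert set_mset_empty)
  then show ?thesis
    using exchange.intros[of "{#p, q#}" "{#P, v#}" W Y k] F P v by auto
qed

lemma exchange_3:
  assumes "finite Y" "set_mset ({#p, q, c#} + W) \<subseteq> words Y k"
    "p' \<in> words Y k" "q' \<in> words Y k" "c' \<in> words Y k"
    "\<And>y. y \<in> Y \<Longrightarrow> {#p y, q y, c y#} = {#p' y, q' y, c' y#}"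
  shows "exchange Y k ({#p, q, c#} + W) ({#p', q', c'#} + W)"
  using assms by (intro exchange.intros) auto

lemma regular_3_of_words:
  assumes "finite Y" "p \<in> words Y k" "q \<in> words Y k" "c \<in> words Y k"
  shows "regular Y k 3 (\<lambda>y. {#p y, q y, c y#})"
  using regular_add[OF regular_word[OF assms(1,4)]
      regular_add[OF regular_word[OF assms(1,3)] regular_word[OF assms(1,2)]]]
  by (simp add: numeral_3_eq_3)

text \<open>Here the rest is 2-regular, and Hall's theorem splits it into \<open>u\<close> and
  \<open>v\<close>.\<close>

lemma exchange_extract_3:
  assumes Y: "finite Y" and F: "set_mset ({#p, q, c#} + W) \<subseteq> words Y k"
    and P: "P \<in> words Y k" "\<And>y. y \<in> Y \<Longrightarrow> P y \<in> {p y, q y, c y}"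
  shows "\<exists>u v. exchange Y k ({#p, q, c#} + W) ({#P, u, v#} + W)"
proof -
  have "regular Y k 3 (\<lambda>y. {#p y, q y, c y#})" using regular_3_of_words[OF Y, of p k q c] F by simp
  then have "regular Y k 2 (\<lambda>y. {#p y, q y, c y#} - {#P y#})"
    by (rule regular_remove[OF Y _ _ P(1)]) (use P(2) in auto)
  then obtain u v where uv: "u \<in> words Y k" "v \<in> words Y k"
      "\<forall>y\<in>Y. {#p y, q y, c y#} - {#P y#} = {#u y, v y#}"
    using regular_2_words[OF Y _ P(1)] by blast
  have "\<forall>y\<in>Y. {#p y, q y, c y#} = {#P y, u y, v y#}"
    using uv(3) P(2) by (metis insert_DiffM insert_iff set_mset_add_mset_insert set_mset_empty)
  then show ?thesis using exchange_3[OF Y F P(1) uv(1,2)] by blast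
qed

lemma word_swap:
  assumes Y: "finite Y" and P: "P \<in> words Y k" and y: "y \<in> Y" "z \<in> Y"
  shows "P(y := P z, z := P y) \<in> words Y k"
proof -
  have "card {x \<in> Y. (P(y := P z, z := P y)) x = c} = card {x \<in> Y. P x = c}" for c
    by (rule bij_betw_same_card[of "id(y := z, z := y)"], rule bij_betw_byWitness[of _ "id(y := z, z := y)"])
      (use y in \<open>auto split: if_splits\<close>)
  then show ?thesis using P y by (auto simp: words_def extensional_def)
qed

text \<open>Induction on the number of positions where \<open>P\<close> differs from
  \<open>M\<close>. The word \<open>P\<close> need not belong to \<open>F\<close>; the pair
  \<open>p\<close>, \<open>q\<close> covers it except perhaps at \<open>z\<close>.\<close>

lemma exchanges_extract_from_pair:
  assumes Y: "finite Y" and M: "M \<in> words Y k"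
    and "set_mset F \<subseteq> words Y k"
    and "\<forall>y\<in>Y. M y \<in># image_mset (\<lambda>w. w y) F"
    and "{#p, q#} \<subseteq># F" "P \<in> words Y k" "z \<in> Y"
    and "\<forall>y\<in>Y - {z}. P y \<in> {p y, q y}"
  shows "\<exists>F'. (exchange Y k)\<^sup>*\<^sup>* F (add_mset M F')"
  using assms(3-)
proof (induction "card {y \<in> Y. P y \<noteq> M y}" arbitrary: F p q P z rule: less_induct)
  case less
  \<comment> \<open>The case \<open>P z \<noteq> M z\<close>, for arbitrary \<open>F\<close>,
    \<open>p\<close>, \<open>q\<close>, \<open>z\<close> but fixed \<open>P\<close>: it serves for
    the given data and again after \<open>P\<close> has become a member.\<close>
  have disagree: "\<exists>F'. (exchange Y k)\<^sup>*\<^sup>* F (add_mset M F')"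
    if F: "set_mset F \<subseteq> words Y k" and cov: "\<forall>y\<in>Y. M y \<in># image_mset (\<lambda>w. w y) F"
      and pq: "{#p, q#} \<subseteq># F" and z: "z \<in> Y" "P z \<noteq> M z"
      and Ppq: "\<forall>y\<in>Y - {z}. P y \<in> {p y, q y}" for F p q z
  proof -
    obtain W where F_eq: "F = add_mset p (add_mset q W)"
      using pq by (auto simp: subset_mset.le_iff_add)
    have P: "P \<in> words Y k" by fact
    \<comment> \<open>The letter \<open>M z\<close> occurs equally often in \<open>P\<close> and in
      \<open>M\<close>, but not at \<open>z\<close> in \<open>P\<close>; so \<open>P\<close> has it
      somewhere that \<open>M\<close> does not.\<close>
    have "\<exists>x\<in>Y. P x = M z \<and> M x \<noteq> M z"
    proof (rule ccontr)
      assume "\<not> ?thesis"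
      then have "{x \<in> Y. P x = M z} \<subset> {x \<in> Y. M x = M z}" using z by auto
      then have "card {x \<in> Y. P x = M z} < card {x \<in> Y. M x = M z}"
        using Y by (simp add: psubset_card_mono)
      then show False using P M by (simp add: words_def)
    qed
    then obtain x where x: "x \<in> Y" "P x = M z" "M x \<noteq> M z" by blast
    \<comment> \<open>The swap repairs \<open>z\<close> and spoils nothing, since \<open>x\<close>
      was a disagreement already. The possibly uncovered position moves from \<open>z\<close> to
      \<open>x\<close>.\<close>
    define P' where "P' = P(z := P x, x := P z)"
    have xz: "x \<noteq> z" using x z by auto
    have P': "P' \<in> words Y k" unfolding P'_def by (rule word_swap) (use Y P z x in auto)
    have "{y \<in> Y. P' y \<noteq> M y} \<subset> {y \<in> Y. P y \<noteq> M y}"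
      using x z xz by (auto simp: P'_def split: if_splits)
    then have d: "card {y \<in> Y. P' y \<noteq> M y} < card {y \<in> Y. P y \<noteq> M y}"
      using Y by (simp add: psubset_card_mono)
    obtain c where c: "c \<in># F" "c z = M z" using cov z(1) by force
    show ?thesis
    proof (cases "c = p \<or> c = q")
      case True
      \<comment> \<open>Here \<open>p\<close> or \<open>q\<close> itself supplies the new letter
        \<open>M z\<close> at \<open>z\<close>, so the pair stays as it is.\<close>
      have "\<forall>y\<in>Y - {x}. P' y \<in> {p y, q y}"
        using True c x xz Ppq by (auto simp: P'_def)
      then show ?thesis using less.hyps[OF d F cov pq P' x(1)] by blast
    next
      case False
      then have "c \<in># W" using c F_eq by auto
      then obtain V where V: "F = {#p, q, c#} + V"
        using F_eq by (auto dest!: multi_member_split)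
      \<comment> \<open>Otherwise \<open>c\<close> supplies it, and the three words are split anew
        so that two of them cover \<open>P'\<close> off \<open>x\<close>.\<close>
      have "\<exists>p'\<in>words Y k. \<exists>q'\<in>words Y k. \<exists>c'\<in>words Y k.
          (\<forall>y\<in>Y. {#p y, q y, c y#} = {#p' y, q' y, c' y#}) \<and> (\<forall>y\<in>Y - {x}. P' y \<in> {p' y, q' y})"
      proof (rule regular_3_words[OF Y _ P' x(1)])
        show "regular Y k 3 (\<lambda>y. {#p y, q y, c y#})"
          using regular_3_of_words[OF Y, of p k q c] F V by simp
        show "P' y \<in># {#p y, q y, c y#}" if "y \<in> Y - {x}" for y
          using that c x xz Ppq by (auto simp: P'_def)
      qed
      then obtain p' q' c' where w: "p' \<in> words Y k" "q' \<in> words Y k" "c' \<in> words Y k"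
        and eq: "\<forall>y\<in>Y. {#p y, q y, c y#} = {#p' y, q' y, c' y#}"
        and P'pq: "\<forall>y\<in>Y - {x}. P' y \<in> {p' y, q' y}" by blast
      define F2 where "F2 = {#p', q', c'#} + V"
      have ex: "exchange Y k F F2"
        unfolding V F2_def by (rule exchange_3[OF Y _ w]) (use F V eq in auto)
      have "\<forall>y\<in>Y. M y \<in># image_mset (\<lambda>w. w y) F2"
        using cov exchange_marginal[OF ex] by simp
      moreover have "{#p', q'#} \<subseteq># F2" by (simp add: F2_def)
      ultimately have "\<exists>F'. (exchange Y k)\<^sup>*\<^sup>* F2 (add_mset M F')"
        using less.hyps[OF d _ _ _ P' x(1) P'pq] exchange_words[OF ex] by blast
      then show ?thesis using ex by (meson converse_rtranclp_into_rtranclp)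
    qed
  qed
  show ?case
  proof (cases "P z = M z")
    case False
    then show ?thesis using disagree less.prems by blast
  next
    case True
    note F = less.prems(1) and cov = less.prems(2) and P = less.prems(4)
    obtain W where F_eq: "F = add_mset p (add_mset q W)"
      using less.prems(3) by (auto simp: subset_mset.le_iff_add)
    obtain c where c: "c \<in># F" "c z = P z" using cov less.prems(5) True by force
    \<comment> \<open>Now \<open>c\<close> supplies \<open>P z\<close>, so \<open>P\<close> is
      covered everywhere and can be split off. The nonempty rest provides a partner
      \<open>q'\<close> for the next pair.\<close>
    have "\<exists>V. exchange Y k F (add_mset P V) \<and> V \<noteq> {#}"
    proof (cases "c = p \<or> c = q")
      case True
      have "P y \<in> {p y, q y}" if "y \<in> Y" for y
        using c less.prems(6) True that by (cases "y = z") auto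
      then obtain q' where "exchange Y k F (add_mset P (add_mset q' W))"
        using exchange_extract_2[OF Y F[unfolded F_eq] P] F_eq by blast
      then show ?thesis by (intro exI[of _ "add_mset q' W"]) simp
    next
      case False
      then have "c \<in># W" using c F_eq by auto
      then obtain V where V: "F = {#p, q, c#} + V"
        using F_eq by (auto dest!: multi_member_split)
      have "P y \<in> {p y, q y, c y}" if "y \<in> Y" for y
        using c less.prems(6) that by (cases "y = z") auto
      then obtain u v where "exchange Y k F ({#P, u, v#} + V)"
        using exchange_extract_3[OF Y F[unfolded V] P] V by blast
      then show ?thesis by (intro exI[of _ "{#u, v#} + V"]) simp
    qed
    then obtain q' W' where ex: "exchange Y k F (add_mset P (add_mset q' W'))"
      by (metis multiset_cases)
    show ?thesis
    proof (cases "P = M")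
      case True
      then show ?thesis using ex by blast
    next
      case False
      \<comment> \<open>As a member, \<open>P\<close> covers itself, so any position of disagreement
        may take the role of \<open>z\<close>.\<close>
      then obtain y where y: "y \<in> Y" "P y \<noteq> M y" using words_eqI[OF P M] by blast
      have "\<exists>F'. (exchange Y k)\<^sup>*\<^sup>* (add_mset P (add_mset q' W')) (add_mset M F')"
        by (rule disagree[OF _ _ _ y, where p = P and q = q'])
          (use exchange_words[OF ex] cov exchange_marginal[OF ex] in auto)
      then show ?thesis using ex by (meson converse_rtranclp_into_rtranclp)
    qed
  qed
qed

lemma exchanges_extract:
  assumes Y: "finite Y" and M: "M \<in> words Y k" and F: "set_mset F \<subseteq> words Y k" "F \<noteq> {#}"
    and cov: "\<And>y. y \<in> Y \<Longrightarrow> M y \<in># image_mset (\<lambda>w. w y) F"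
  shows "\<exists>F'. (exchange Y k)\<^sup>*\<^sup>* F (add_mset M F')"
proof -
  obtain p W where p: "F = add_mset p W" using F(2) by (metis multiset_cases)
  show ?thesis
  proof (cases "W = {#} \<or> Y = {}")
    \<comment> \<open>A single word covering \<open>M\<close> equals \<open>M\<close>, and over an
      empty \<open>Y\<close> all words coincide.\<close>
    case True
    have "M = p" by (rule words_eqI[OF M]) (use True F p cov in auto)
    then show ?thesis using p by blast
  next
    case False
    then obtain q W' z where "W = add_mset q W'" "z \<in> Y" by (metis multiset_cases ex_in_conv)
    then show ?thesis
      using exchanges_extract_from_pair[OF Y M F(1), of p q p z] p F(1) cov by auto
  qed
qed

text \<open>Members of \<open>H\<close> are peeled off one at a time: equal marginals make every
  letter of \<open>M\<close> available in \<open>F\<close>, so \<open>M\<close> can be produced and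
  cancelled on both sides. Sizes are compared separately because marginals say nothing when
  \<open>Y\<close> is empty.\<close>

theorem exchanges_connected:
  assumes Y: "finite Y" and "set_mset F \<subseteq> words Y k" "set_mset H \<subseteq> words Y k" "size F = size H"
    and "\<And>y. y \<in> Y \<Longrightarrow> image_mset (\<lambda>w. w y) F = image_mset (\<lambda>w. w y) H"
  shows "(exchange Y k)\<^sup>*\<^sup>* F H"
  using assms(2-)
proof (induction H arbitrary: F)
  case (add M H)
  have M: "M \<in> words Y k" using add.prems by simp
  have "F \<noteq> {#}" using add.prems(3) by auto
  then obtain F' where F': "(exchange Y k)\<^sup>*\<^sup>* F (add_mset M F')"
    using exchanges_extract[OF Y M add.prems(1)] add.prems(4) by auto
  note inv = exchanges_invariants[OF F']
  have "(exchange Y k)\<^sup>*\<^sup>* F' H"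
    by (rule add.IH) (use inv add.prems in auto)
  then show ?case using F' exchanges_add_mset[OF _ M] by (meson rtranclp_trans)
qed simp

section \<open>Injections as words\<close>

text \<open>An injection \<open>\<sigma>\<close> is recorded from the side of its values: the position \<open>y\<close> carries the letter
  \<open>x\<close> if \<open>\<sigma> x = y\<close>, and the letter \<open>0\<close> (used \<open>n - r\<close> times) if \<open>y\<close> is not a value of \<open>\<sigma>\<close>.\<close>

definition content :: "nat \<Rightarrow> nat \<Rightarrow> nat \<Rightarrow> nat" where
  "content n r c = (if c = 0 then n - r else if c \<le> r then 1 else 0)"

definition encode :: "nat \<Rightarrow> nat \<Rightarrow> (nat \<Rightarrow> nat) \<Rightarrow> nat \<Rightarrow> nat" where
  "encode n r \<sigma> =
     (\<lambda>y\<in>{1..n}. if y \<in> \<sigma> ` {1..r} then the_inv_into {1..r} \<sigma> y else 0)"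

definition decode :: "nat \<Rightarrow> nat \<Rightarrow> (nat \<Rightarrow> nat) \<Rightarrow> nat \<Rightarrow> nat" where
  "decode n r w = (\<lambda>x\<in>{1..r}. THE y. y \<in> {1..n} \<and> w y = x)"

lemma encode_eq_iff:
  assumes "\<sigma> \<in> injections n r" "y \<in> {1..n}" "x \<in> {1..r}"
  shows "encode n r \<sigma> y = x \<longleftrightarrow> \<sigma> x = y"
proof -
  have inj: "inj_on \<sigma> {1..r}" using assms(1) by (simp add: injections_def)
  show ?thesis
  proof (cases "y \<in> \<sigma> ` {1..r}")
    case True
    then obtain z where z: "z \<in> {1..r}" "y = \<sigma> z" by blast
    then have "encode n r \<sigma> y = z"
      using assms(2) the_inv_into_f_f[OF inj z(1)] by (simp add: encode_def)
    then show ?thesis using z inj_on_eq_iff[OF inj assms(3) z(1)] by auto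
  next
    case False
    then have "encode n r \<sigma> y = 0" using assms(2) by (simp add: encode_def)
    \<comment> \<open>The default letter \<open>0\<close> differs from \<open>x\<close>, because
      \<open>x \<ge> 1\<close>.\<close>
    then show ?thesis using False assms(3) by auto
  qed
qed

lemma encode_le:
  assumes "\<sigma> \<in> injections n r" "y \<in> {1..n}"
  shows "encode n r \<sigma> y \<le> r"
proof -
  have inj: "inj_on \<sigma> {1..r}" using assms(1) by (simp add: injections_def)
  show ?thesis
    using assms(2) the_inv_into_into[OF inj _ subset_refl, of y] by (auto simp: encode_def)
qed

text \<open>Recording by values turns injectivity into an exact content. Recorded by arguments, each
  value would occur at most once, which is no fixed content when \<open>r < n\<close>.\<close>

lemma encode_in_words:
  assumes \<sigma>: "\<sigma> \<in> injections n r"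
  shows "encode n r \<sigma> \<in> words {1..n} (content n r)"
proof -
  have inj: "inj_on \<sigma> {1..r}" and sub: "\<sigma> ` {1..r} \<subseteq> {1..n}"
    using \<sigma> by (auto simp: injections_def)
  have "card {y \<in> {1..n}. encode n r \<sigma> y = c} = content n r c" for c
  proof -
    consider "c = 0" | "c \<in> {1..r}" | "c > r" by force
    then show ?thesis
    proof cases
      case 1
      have "{y \<in> {1..n}. encode n r \<sigma> y = 0} = {1..n} - \<sigma> ` {1..r}"
        using the_inv_into_into[OF inj _ subset_refl] by (force simp: encode_def)
      then show ?thesis
        using 1 sub card_image[OF inj] by (simp add: content_def card_Diff_subset)
    next
      case 2
      then have c: "\<sigma> c \<in> {1..n}" using sub by blast
      have "y \<in> {1..n} \<and> encode n r \<sigma> y = c \<longleftrightarrow> y = \<sigma> c" for y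
        using encode_eq_iff[OF \<sigma> _ 2, of y] c by (cases "y \<in> {1..n}") auto
      then have "{y \<in> {1..n}. encode n r \<sigma> y = c} = {\<sigma> c}"
        by (simp only: singleton_conv)
      then have "card {y \<in> {1..n}. encode n r \<sigma> y = c} = Suc 0"
        unfolding card_1_singleton_iff by blast
      moreover have "content n r c = Suc 0" using 2 by (simp add: content_def)
      ultimately show ?thesis by (simp only:)
    next
      case 3
      then have "{y \<in> {1..n}. encode n r \<sigma> y = c} = {}"
        using encode_le[OF \<sigma>] by fastforce
      then show ?thesis using 3 by (simp only: content_def card.empty) auto
    qed
  qed
  then show ?thesis by (simp add: words_def encode_def)
qed

text \<open>A letter of \<open>{1..r}\<close> has content one, so the description in
  \<open>decode\<close> has exactly one solution.\<close>

lemma decode_eq_iff: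
  assumes w: "w \<in> words {1..n} (content n r)" and x: "x \<in> {1..r}"
  shows "decode n r w x \<in> {1..n}" and "y \<in> {1..n} \<Longrightarrow> decode n r w x = y \<longleftrightarrow> w y = x"
proof -
  have "card {y \<in> {1..n}. w y = x} = 1" using w x by (auto simp: words_def content_def)
  then obtain z where z: "{y \<in> {1..n}. w y = x} = {z}" by (rule card_1_singletonE)
  then have iff: "y \<in> {1..n} \<and> w y = x \<longleftrightarrow> y = z" for y by blast
  have "decode n r w x = z" using x by (simp only: decode_def iff restrict_apply) simp
  then show "decode n r w x \<in> {1..n}" "y \<in> {1..n} \<Longrightarrow> decode n r w x = y \<longleftrightarrow> w y = x"
    using iff[of y] iff[of z] by auto
qed

lemma decode_in_injections:
  assumes "w \<in> words {1..n} (content n r)"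
  shows "decode n r w \<in> injections n r"
proof -
  have "inj_on (decode n r w) {1..r}"
  proof (rule inj_onI)
    fix a b assume ab: "a \<in> {1..r}" "b \<in> {1..r}" "decode n r w a = decode n r w b"
    let ?y = "decode n r w a"
    have "?y \<in> {1..n}" using decode_eq_iff(1)[OF assms ab(1)] .
    then have "w ?y = a" "w ?y = b"
      using decode_eq_iff(2)[OF assms ab(1), of ?y] decode_eq_iff(2)[OF assms ab(2), of ?y] ab(3)
      by simp_all
    then show "a = b" by simp
  qed
  then show ?thesis using decode_eq_iff(1)[OF assms] by (auto simp: injections_def decode_def)
qed

lemma decode_encode:
  assumes "\<sigma> \<in> injections n r"
  shows "decode n r (encode n r \<sigma>) = \<sigma>"
proof (rule extensionalityI[of _ "{1..r}"])
  show "decode n r (encode n r \<sigma>) \<in> extensional {1..r}" by (simp add: decode_def)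
  show "\<sigma> \<in> extensional {1..r}" using assms by (simp add: injections_def PiE_def)
  fix x assume x: "x \<in> {1..r}"
  then have y: "\<sigma> x \<in> {1..n}" using assms unfolding injections_def by blast
  then show "decode n r (encode n r \<sigma>) x = \<sigma> x"
    using decode_eq_iff(2)[OF encode_in_words[OF assms] x y] encode_eq_iff[OF assms y x] by simp
qed

section \<open>Transport of marginals between injections and words\<close>

lemma count_image_mset_filter: "count (image_mset f A) c = size {#x \<in># A. f x = c#}"
  by (induction A) simp_all

text \<open>\<open>count A a\<close> is the size minus all other counts. The exceptional element
  will be the letter \<open>0\<close>, which the marginals of injections do not show
  directly.\<close>

lemma mset_eqI_size:
  fixes A B :: "'a multiset"
  assumes "size A = size B" "\<And>c. c \<noteq> a \<Longrightarrow> count A c = count B c"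
  shows "A = B"
proof -
  have eq: "filter_mset (\<lambda>x. x \<noteq> a) A = filter_mset (\<lambda>x. x \<noteq> a) B"
  proof (rule multiset_eqI)
    show "count (filter_mset (\<lambda>x. x \<noteq> a) A) c = count (filter_mset (\<lambda>x. x \<noteq> a) B) c" for c
      using assms(2)[of c] by (cases "c = a") simp_all
  qed
  have "size (filter_mset (\<lambda>x. x \<noteq> a) C) + count C a = size C" for C :: "'a multiset"
    by (induction C) auto
  from this[of A] this[of B] have "count A a = count B a" using eq assms(1) by simp
  then show ?thesis using assms(2) by (metis multiset_eqI)
qed

text \<open>For \<open>c\<close> in \<open>{1..r}\<close>, the letter \<open>c\<close> stands at
  \<open>y\<close> iff \<open>\<sigma> c = y\<close>, so its count is read off from the marginal at
  \<open>c\<close>. The count of \<open>0\<close> then follows from the sizes.\<close>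

lemma encode_marginals:
  assumes F: "set_mset F \<subseteq> injections n r" and H: "set_mset H \<subseteq> injections n r"
    and size: "size F = size H"
    and marg: "\<And>x. x \<in> {1..r} \<Longrightarrow> image_mset (\<lambda>\<sigma>. \<sigma> x) F = image_mset (\<lambda>\<sigma>. \<sigma> x) H"
    and y: "y \<in> {1..n}"
  shows "image_mset (\<lambda>w. w y) (image_mset (encode n r) F)
       = image_mset (\<lambda>w. w y) (image_mset (encode n r) H)"
proof -
  have *: "count (image_mset (\<lambda>\<sigma>. encode n r \<sigma> y) A) c =
      (if c \<in> {1..r} then count (image_mset (\<lambda>\<sigma>. \<sigma> c) A) y else 0)"
    if A: "set_mset A \<subseteq> injections n r" and c: "c \<noteq> 0" for A c
  proof (cases "c \<in> {1..r}")
    case True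
    have "filter_mset (\<lambda>\<sigma>. encode n r \<sigma> y = c) A = filter_mset (\<lambda>\<sigma>. \<sigma> c = y) A"
      using encode_eq_iff[OF _ y True] A by (intro filter_mset_cong) auto
    then show ?thesis using True by (simp add: count_image_mset_filter)
  next
    case False
    then have "filter_mset (\<lambda>\<sigma>. encode n r \<sigma> y = c) A = {#}"
      using encode_le[OF _ y] A c by (fastforce simp: filter_mset_eq_mempty_iff)
    then show ?thesis using False by (simp only: count_image_mset_filter) simp
  qed
  show ?thesis
    unfolding image_mset.compositionality o_def
    by (rule mset_eqI_size[of _ _ 0]) (simp_all add: size *[OF F] *[OF H] marg)
qed

text \<open>The same transposition of counts backwards; since \<open>decode\<close> takes its values
  in \<open>{1..n}\<close>, all counts outside vanish.\<close>

lemma decode_marginals: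
  assumes A: "set_mset A \<subseteq> words {1..n} (content n r)" and B: "set_mset B \<subseteq> words {1..n} (content n r)"
    and marg: "\<And>y. y \<in> {1..n} \<Longrightarrow> image_mset (\<lambda>w. w y) A = image_mset (\<lambda>w. w y) B"
    and x: "x \<in> {1..r}"
  shows "image_mset (\<lambda>\<sigma>. \<sigma> x) (image_mset (decode n r) A)
       = image_mset (\<lambda>\<sigma>. \<sigma> x) (image_mset (decode n r) B)"
proof -
  have *: "count (image_mset (\<lambda>w. decode n r w x) A) y =
      (if y \<in> {1..n} then count (image_mset (\<lambda>w. w y) A) x else 0)"
    if A: "set_mset A \<subseteq> words {1..n} (content n r)" for A y
  proof (cases "y \<in> {1..n}")
    case True
    have "filter_mset (\<lambda>w. decode n r w x = y) A = filter_mset (\<lambda>w. w y = x) A"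
      using decode_eq_iff(2)[OF _ x True] A by (intro filter_mset_cong) auto
    then show ?thesis using True by (simp add: count_image_mset_filter)
  next
    case False
    then have "filter_mset (\<lambda>w. decode n r w x = y) A = {#}"
      using decode_eq_iff(1)[OF _ x] A by (fastforce simp: filter_mset_eq_mempty_iff)
    then show ?thesis using False by (simp only: count_image_mset_filter) simp
  qed
  show ?thesis
    unfolding image_mset.compositionality o_def
    by (rule multiset_eqI) (simp add: *[OF A] *[OF B] marg)
qed

section \<open>Monomials as multisets\<close>

text \<open>Multisets of indeterminates replace exponent functions, so that \<open>encode\<close>
  and \<open>decode\<close> act member by member through \<open>image_mset\<close>.\<close>

definition mon_of :: "'v multiset \<Rightarrow> 'v mon" where
  "mon_of A = (\<Sum>x\<in>#A. Poly_Mapping.single x 1)"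

lemma mon_of_simps [simp]:
  "mon_of {#} = 0"
  "mon_of (add_mset x A) = Poly_Mapping.single x 1 + mon_of A"
  "mon_of (A + B) = mon_of A + mon_of B"
  by (simp_all add: mon_of_def)

lemma lookup_mon_of: "Poly_Mapping.lookup (mon_of A) x = count A x"
  by (induction A) (auto simp: lookup_add lookup_single when_def)

lemma keys_mon_of [simp]: "Poly_Mapping.keys (mon_of A) = set_mset A"
  by (auto simp: in_keys_iff lookup_mon_of)

lemma mon_degree_mon_of: "mon_degree (mon_of A) = size A"
  by (simp add: mon_degree_def lookup_mon_of size_multiset_overloaded_eq)

lemma mon_of_inject: "mon_of A = mon_of B \<longleftrightarrow> A = B"
  by (metis lookup_mon_of multiset_eqI)

lemma mon_of_surj: "\<exists>A. u = mon_of A"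
proof -
  have "count (\<Sum>x\<in>Poly_Mapping.keys u. replicate_mset (Poly_Mapping.lookup u x) x) y = Poly_Mapping.lookup u y" for y
    by (simp add: count_sum in_keys_iff)
  then show ?thesis by (metis lookup_mon_of poly_mapping_eqI)
qed

lemma mmon_add: "mmon (u + v) = mmon u * mmon v"
  by (simp add: mmon_def mult_single)

lemma mmon_zero [simp]: "mmon 0 = 1"
  by (simp add: mmon_def)

text \<open>This is the matrix \<open>A_{n,r}\<close> applied to the exponent vector of
  \<open>mon_of A\<close>, that is, the exponent of the image monomial.\<close>

definition marginals :: "nat \<Rightarrow> (nat \<Rightarrow> nat) multiset \<Rightarrow> (nat \<times> nat) mon" where
  "marginals r A = (\<Sum>\<sigma>\<in>#A. \<Sum>j\<in>{1..r}. Poly_Mapping.single (j, \<sigma> j) 1)"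

lemma prod_mvar: "finite S \<Longrightarrow> (\<Prod>x\<in>S. mvar (f x)) = mmon (\<Sum>x\<in>S. Poly_Mapping.single (f x) 1)"
  by (induction S rule: finite_induct) (simp_all add: mmon_add mvar_def)

lemma mon_subst_mon_of: "mon_subst \<phi> (mon_of A) = (\<Prod>x\<in>#A. \<phi> x)"
proof (induction A)
  case (add x A)
  then show ?case by (simp add: mon_subst_add) (simp add: mon_subst_def)
qed (simp add: mon_subst_def)

lemma birkhoff_map_mmon: "birkhoff_map r (mmon (mon_of A)) = mmon (marginals r A)"
proof -
  have "birkhoff_map r (mmon (mon_of A)) = (\<Prod>\<sigma>\<in>#A. \<Prod>j\<in>{1..r}. mvar (j, \<sigma> j))"
    by (simp add: birkhoff_map_def mmon_def mpol_subst_single mon_subst_mon_of mconst_def)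
  also have "\<dots> = mmon (marginals r A)"
    by (induction A) (simp_all add: marginals_def mmon_add prod_mvar)
  finally show ?thesis .
qed

lemma lookup_marginals:
  "Poly_Mapping.lookup (marginals r A) (x, y) =
    (if x \<in> {1..r} then count (image_mset (\<lambda>\<sigma>. \<sigma> x) A) y else 0)"
proof (induction A)
  case (add \<sigma> A)
  have "Poly_Mapping.lookup (\<Sum>j\<in>{1..r}. Poly_Mapping.single (j, \<sigma> j) 1) (x, y)
      = (\<Sum>j\<in>{1..r}. if j = x then (if \<sigma> x = y then 1 else 0) else 0)"
    unfolding lookup_sum by (intro sum.cong) (auto simp: lookup_single when_def)
  also have "\<dots> = (if x \<in> {1..r} then (if \<sigma> x = y then 1 else 0) else 0)" by (simp del: sum.delta add: sum.delta)
  finally show ?case using add by (auto simp: marginals_def lookup_add simp del: One_nat_def)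
qed (simp add: marginals_def)

lemma marginals_eq_iff:
  "marginals r A = marginals r B \<longleftrightarrow>
    (\<forall>x\<in>{1..r}. image_mset (\<lambda>\<sigma>. \<sigma> x) A = image_mset (\<lambda>\<sigma>. \<sigma> x) B)"
proof
  assume eq: "marginals r A = marginals r B"
  show "\<forall>x\<in>{1..r}. image_mset (\<lambda>\<sigma>. \<sigma> x) A = image_mset (\<lambda>\<sigma>. \<sigma> x) B"
    using eq by (metis lookup_marginals multiset_eqI)
next
  assume "\<forall>x\<in>{1..r}. image_mset (\<lambda>\<sigma>. \<sigma> x) A = image_mset (\<lambda>\<sigma>. \<sigma> x) B"
  then show "marginals r A = marginals r B"
    by (intro poly_mapping_eqI) (auto simp: lookup_marginals)
qed

lemma marginals_eq_size:
  assumes "marginals r A = marginals r B" "r \<ge> 1"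
  shows "size A = size B"
proof -
  have "image_mset (\<lambda>\<sigma>. \<sigma> 1) A = image_mset (\<lambda>\<sigma>. \<sigma> 1) B"
    using assms by (simp add: marginals_eq_iff)
  then show ?thesis by (metis size_image_mset)
qed

lemma mconst_sum: "mconst (sum f A) = (\<Sum>x\<in>A. mconst (f x))"
  by (induction A rule: infinite_finite_induct) (simp_all add: mconst_def single_add)

lemma mpol_decomp_mmon:
  "f = (\<Sum>u\<in>Poly_Mapping.keys f. mconst (Poly_Mapping.lookup f u) * mmon u)"
  by (subst mpol_decomp) (simp add: mconst_def mmon_def mult_single)

section \<open>Generators of the toric ideal\<close>

text \<open>\<open>A \<noteq> B\<close> keeps out the zero polynomial, whose total degree is
  \<open>0\<close> by convention.\<close>

definition small_binomials :: "nat \<Rightarrow> nat \<Rightarrow> (nat \<Rightarrow> nat, 'k::field) mpol set" where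
  "small_binomials n r =
     {mmon (mon_of A) - mmon (mon_of B) | A B.
        set_mset (A + B) \<subseteq> injections n r \<and> marginals r A = marginals r B \<and>
        A \<noteq> B \<and> size A = size B \<and> (size A = 2 \<or> size A = 3)}"

text \<open>Distinct monomials cannot cancel, over any field, so both survive as keys.\<close>

lemma total_degree_binomial:
  assumes "A \<noteq> B" "size A = size B"
  shows "total_degree (mmon (mon_of A) - mmon (mon_of B) :: ('v, 'k::field) mpol) = size A"
proof -
  have "Poly_Mapping.keys (mmon (mon_of A) - mmon (mon_of B) :: ('v, 'k) mpol) = {mon_of A, mon_of B}"
    using assms(1)
    by (auto simp: in_keys_iff lookup_minus mmon_def lookup_single when_def mon_of_inject split: if_splits)
  then show ?thesis using assms(2) by (simp add: total_degree_def mon_degree_mon_of)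
qed

lemma mmon_in_mpol_ring: "Poly_Mapping.keys u \<subseteq> V \<Longrightarrow> mmon u \<in> carrier (mpol_ring V)"
  by (simp add: mpol_ring_simps mmon_def)

lemma mpol_ring_minus:
  assumes "f \<in> carrier (mpol_ring V)" "g \<in> carrier (mpol_ring V)"
  shows "f - g \<in> carrier (mpol_ring V)"
  using assms keys_diff[of f g] by (fastforce simp: mpol_ring_simps)

lemma small_binomials_carrier: "small_binomials n r \<subseteq> carrier (birkhoff_source n r)"
  by (auto simp: small_binomials_def birkhoff_source_def intro!: mpol_ring_minus mmon_in_mpol_ring)

section \<open>Closure properties of ideals, in type-class notation\<close>

context
  fixes I :: "('v, 'k::field) mpol set" and V
  assumes I: "ideal I (mpol_ring V)"
begin

lemma mpol_ideal_add: "f \<in> I \<Longrightarrow> g \<in> I \<Longrightarrow> f + g \<in> I"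
  using additive_subgroup.a_closed[OF ideal.axioms(1)[OF I]] by (simp add: mpol_ring_simps)

lemma mpol_ideal_zero: "0 \<in> I"
  using additive_subgroup.zero_closed[OF ideal.axioms(1)[OF I]] by (simp add: mpol_ring_simps)

lemma mpol_ideal_mult: "f \<in> I \<Longrightarrow> g \<in> carrier (mpol_ring V) \<Longrightarrow> g * f \<in> I"
  using ideal.I_l_closed[OF I, of f g] by (simp add: mpol_ring_simps(2-))

lemma mpol_ideal_sum: "(\<And>x. x \<in> A \<Longrightarrow> f x \<in> I) \<Longrightarrow> sum f A \<in> I"
  by (induction A rule: infinite_finite_induct) (auto intro: mpol_ideal_add mpol_ideal_zero)

end

lemma ideal_small_binomials:
  "ideal (Idl\<^bsub>mpol_ring (injections n r)\<^esub> small_binomials n r) (mpol_ring (injections n r))"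
  using small_binomials_carrier[of n r]
  by (intro ring.genideal_ideal cring.axioms(1) cring_mpol_ring) (simp add: birkhoff_source_def)

text \<open>Multiply by the cofactor \<open>mmon (mon_of W)\<close>. A trivial exchange
  \<open>A = B\<close> contributes zero, which is not among the generators.\<close>

lemma small_binomials_step:
  assumes "set_mset (A + B + W) \<subseteq> injections n r" "size A = size B" "size A = 2 \<or> size A = 3"
    and "marginals r A = marginals r B"
  shows "mmon (mon_of (A + W)) - mmon (mon_of (B + W)) \<in>
    Idl\<^bsub>mpol_ring (injections n r)\<^esub> (small_binomials n r :: (nat \<Rightarrow> nat, 'k::field) mpol set)"
    (is "_ \<in> ?I")
proof -
  have "mmon (mon_of A) - mmon (mon_of B) \<in> ?I"
  proof (cases "A = B")
    case True
    then show ?thesis using mpol_ideal_zero[OF ideal_small_binomials] by simp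
  next
    case False
    then have "mmon (mon_of A) - mmon (mon_of B) \<in> (small_binomials n r :: (_, 'k) mpol set)"
      unfolding small_binomials_def using assms
      by (intro CollectI exI[of _ A] exI[of _ B]) auto
    then show ?thesis
      using ring.genideal_self[OF cring.axioms(1)[OF cring_mpol_ring]] small_binomials_carrier
      unfolding birkhoff_source_def by blast
  qed
  then have "mmon (mon_of W) * (mmon (mon_of A) - mmon (mon_of B)) \<in> ?I"
    using assms(1) by (intro mpol_ideal_mult[OF ideal_small_binomials] mmon_in_mpol_ring) auto
  then show ?thesis by (simp add: mmon_add algebra_simps)
qed

text \<open>The differences along the chain of exchanges telescope.\<close>

lemma exchanges_in_ideal:
  assumes "(exchange {1..n} (content n r))\<^sup>*\<^sup>* F H"
  shows "mmon (mon_of (image_mset (decode n r) F)) - mmon (mon_of (image_mset (decode n r) H)) \<in>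
    Idl\<^bsub>mpol_ring (injections n r)\<^esub> (small_binomials n r :: (nat \<Rightarrow> nat, 'k::field) mpol set)"
    (is "_ \<in> ?I")
  using assms
proof (induction rule: rtranclp_induct)
  case base
  then show ?case using mpol_ideal_zero[OF ideal_small_binomials] by simp
next
  case (step H J)
  let ?m = "\<lambda>F. mmon (mon_of (image_mset (decode n r) F)) :: (nat \<Rightarrow> nat, 'k) mpol"
  from step(2) have "?m H - ?m J \<in> ?I"
  proof cases
    case (1 A B W)
    have "marginals r (image_mset (decode n r) A) = marginals r (image_mset (decode n r) B)"
      unfolding marginals_eq_iff using 1 by (intro ballI decode_marginals) auto
    then show ?thesis
      unfolding 1 image_mset_union
      using 1 decode_in_injections by (intro small_binomials_step) auto
  qed
  then have "(?m F - ?m H) + (?m H - ?m J) \<in> ?I"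
    using step.IH by (intro mpol_ideal_add[OF ideal_small_binomials])
  then show ?case by simp
qed

text \<open>Encode both sides, join them by exchanges of words, and decode the chain.\<close>

lemma binomial_in_ideal:
  assumes "set_mset A \<subseteq> injections n r" "set_mset B \<subseteq> injections n r"
    and "marginals r A = marginals r B" "r \<ge> 1"
  shows "mmon (mon_of A) - mmon (mon_of B) \<in>
    Idl\<^bsub>mpol_ring (injections n r)\<^esub> (small_binomials n r :: (nat \<Rightarrow> nat, 'k::field) mpol set)"
proof -
  have dec: "image_mset (decode n r) (image_mset (encode n r) C) = C"
    if "set_mset C \<subseteq> injections n r" for C
    using that decode_encode
    by (auto simp: image_mset.compositionality intro!: image_mset_cong[of _ _ id, simplified])
  have "(exchange {1..n} (content n r))\<^sup>*\<^sup>* (image_mset (encode n r) A) (image_mset (encode n r) B)"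
  proof (rule exchanges_connected)
    fix y assume "y \<in> {1..n}"
    then show "image_mset (\<lambda>w. w y) (image_mset (encode n r) A) = image_mset (\<lambda>w. w y) (image_mset (encode n r) B)"
      using assms marginals_eq_size[OF assms(3,4)] by (intro encode_marginals) (auto simp: marginals_eq_iff)
  qed (use assms encode_in_words marginals_eq_size[OF assms(3,4)] in auto)
  from exchanges_in_ideal[OF this] show ?thesis by (simp only: dec assms)
qed

section \<open>The two inclusions between the toric ideal and the generated ideal\<close>

text \<open>The terms of \<open>f\<close> are grouped into fibres by their image monomial, and each
  is compared with one representative of its fibre.\<close>

lemma toric_ideal_subset:
  assumes "r \<ge> 1" and f: "f \<in> birkhoff_toric_ideal n r"
  shows "f \<in> Idl\<^bsub>mpol_ring (injections n r)\<^esub> (small_binomials n r :: (nat \<Rightarrow> nat, 'k::field) mpol set)"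
    (is "_ \<in> ?I")
proof -
  let ?K = "Poly_Mapping.keys f" and ?c = "Poly_Mapping.lookup f"
  have supp: "\<And>u. u \<in> ?K \<Longrightarrow> Poly_Mapping.keys u \<subseteq> injections n r" and ker: "birkhoff_map r f = 0"
    using f by (auto simp: birkhoff_toric_ideal_def a_kernel_def' birkhoff_source_def
        birkhoff_target_def mpol_ring_simps)
  obtain ms :: "(nat \<Rightarrow> nat) mon \<Rightarrow> (nat \<Rightarrow> nat) multiset" where ms: "\<And>u. mon_of (ms u) = u" using mon_of_surj by metis
  define t where "t u = marginals r (ms u)" for u
  define rep where "rep s = (SOME u. u \<in> ?K \<and> t u = s)" for s
  have rep: "rep (t u) \<in> ?K \<and> t (rep (t u)) = t u" if "u \<in> ?K" for u
    unfolding rep_def by (rule someI[of _ u]) (use that in simp)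
  \<comment> \<open>Distinct monomials are linearly independent, so the coefficient of
    \<open>mmon s\<close> in the image, which is the sum over the fibre of \<open>s\<close>,
    vanishes.\<close>
  have zero: "(\<Sum>u\<in>{u \<in> ?K. t u = s}. ?c u) = 0" for s
  proof -
    have "birkhoff_map r f = (\<Sum>u\<in>?K. mconst (?c u) * mmon (t u))"
      unfolding birkhoff_map_def mpol_subst_def
    proof (intro sum.cong refl)
      fix u
      have "mon_subst (\<lambda>\<sigma>. \<Prod>j\<in>{1..r}. mvar (j, \<sigma> j)) u = (mmon (t u) :: (nat \<times> nat, 'k) mpol)"
        using birkhoff_map_mmon[of r "ms u", where 'a = 'k]
        unfolding ms t_def birkhoff_map_def by (simp add: mmon_def mpol_subst_single mconst_def)
      then show "mconst (?c u) * mon_subst (\<lambda>\<sigma>. \<Prod>j\<in>{1..r}. mvar (j, \<sigma> j)) u = mconst (?c u) * mmon (t u)"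
        by simp
    qed
    then have "0 = Poly_Mapping.lookup (\<Sum>u\<in>?K. mconst (?c u) * mmon (t u)) s" using ker by simp
    also have "\<dots> = (\<Sum>u\<in>?K. if t u = s then ?c u else 0)"
      by (simp add: lookup_sum mconst_def mmon_def mult_single lookup_single when_def)
    also have "\<dots> = (\<Sum>u\<in>{u \<in> ?K. t u = s}. ?c u)"
      by (simp add: sum.If_cases Int_def)
    finally show ?thesis by simp
  qed
  \<comment> \<open>Each fibre contributes its vanishing coefficient sum times one monomial, so
    subtracting the representatives does not change \<open>f\<close>.\<close>
  have "(\<Sum>u\<in>?K. mconst (?c u) * mmon (rep (t u))) = 
      (\<Sum>s\<in>t ` ?K. \<Sum>u\<in>{u \<in> ?K. t u = s}. mconst (?c u) * mmon (rep (t u)))"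
    by (rule sum.image_gen) simp
  also have "\<dots> = (\<Sum>s\<in>t ` ?K. mconst (\<Sum>u\<in>{u \<in> ?K. t u = s}. ?c u) * mmon (rep s))"
    by (intro sum.cong refl) (simp add: mconst_sum sum_distrib_right)
  also have "\<dots> = 0" by (simp add: zero) (simp add: mconst_def)
  finally have f_eq: "f = (\<Sum>u\<in>?K. mconst (?c u) * (mmon u - mmon (rep (t u))))"
    by (simp add: right_diff_distrib sum_subtractf flip: mpol_decomp_mmon)
  have "mmon u - mmon (rep (t u)) \<in> ?I" if u: "u \<in> ?K" for u
  proof -
    have keys: "set_mset (ms v) = Poly_Mapping.keys v" for v
      using keys_mon_of[of "ms v"] by (simp add: ms)
    have "marginals r (ms u) = marginals r (ms (rep (t u)))"
      using rep[OF u] by (simp add: t_def)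
    then have "mmon (mon_of (ms u)) - mmon (mon_of (ms (rep (t u)))) \<in> ?I"
      using supp[OF u] supp[of "rep (t u)"] rep[OF u] assms(1)
      by (intro binomial_in_ideal) (simp_all add: keys)
    then show ?thesis by (simp add: ms)
  qed
  then have "(\<Sum>u\<in>?K. mconst (?c u) * (mmon u - mmon (rep (t u)))) \<in> ?I"
    by (intro mpol_ideal_sum[OF ideal_small_binomials]
        mpol_ideal_mult[OF ideal_small_binomials _ mconst_in_mpol_ring])
  then show ?thesis by (subst f_eq)
qed

text \<open>Equal marginals mean equal image monomials.\<close>

lemma small_binomials_subset_toric_ideal:
  "small_binomials n r \<subseteq> (birkhoff_toric_ideal n r :: (nat \<Rightarrow> nat, 'k::field) mpol set)"
proof
  fix f :: "(nat \<Rightarrow> nat, 'k) mpol" assume f: "f \<in> small_binomials n r"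
  have hom_minus: "birkhoff_map r (g - h) = birkhoff_map r g - birkhoff_map r h"
    for g h :: "(nat \<Rightarrow> nat, 'k) mpol"
    unfolding birkhoff_map_def eq_diff_eq by (subst mpol_subst_add[symmetric]) simp
  have "birkhoff_map r f = 0"
    using f by (auto simp: small_binomials_def hom_minus birkhoff_map_mmon)
  moreover have "f \<in> carrier (birkhoff_source n r)" using f small_binomials_carrier by blast
  ultimately show "f \<in> birkhoff_toric_ideal n r"
    by (simp add: birkhoff_toric_ideal_def a_kernel_def' birkhoff_target_def mpol_ring_simps(5))
qed

lemma ideal_birkhoff_toric_ideal:
  "ideal (birkhoff_toric_ideal n r) (birkhoff_source n r)"
  unfolding birkhoff_toric_ideal_def
  by (intro ring_hom_ring.kernel_is_ideal ring_hom_ringI2 birkhoff_map_hom)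
    (simp_all add: birkhoff_source_def birkhoff_target_def cring.axioms(1) cring_mpol_ring)

theorem theorem2p1:
  fixes n r :: nat
  assumes "r \<ge> 2" and "n \<ge> 3" and "r \<le> n"
  shows "\<exists>G :: (nat \<Rightarrow> nat, 'k::field) mpol set.
           G \<subseteq> carrier (birkhoff_source n r) \<and>
           (\<forall>g\<in>G. is_binomial g \<and> (total_degree g = 2 \<or> total_degree g = 3)) \<and>
           birkhoff_toric_ideal n r = Idl\<^bsub>birkhoff_source n r\<^esub> G"
proof (intro exI conjI)
  show "small_binomials n r \<subseteq> carrier (birkhoff_source n r)" by (rule small_binomials_carrier)
  show "\<forall>g\<in>small_binomials n r :: (nat \<Rightarrow> nat, 'k) mpol set.
      is_binomial g \<and> (total_degree g = 2 \<or> total_degree g = 3)"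
    by (auto simp: small_binomials_def is_binomial_def total_degree_binomial)
  show "birkhoff_toric_ideal n r = Idl\<^bsub>birkhoff_source n r\<^esub> (small_binomials n r :: (nat \<Rightarrow> nat, 'k) mpol set)"
  proof
    show "birkhoff_toric_ideal n r \<subseteq> Idl\<^bsub>birkhoff_source n r\<^esub> (small_binomials n r :: (nat \<Rightarrow> nat, 'k) mpol set)"
      unfolding birkhoff_source_def using toric_ideal_subset[of r] assms(1) by auto
    have "ring (birkhoff_source n r :: (nat \<Rightarrow> nat, 'k) mpol ring)"
      unfolding birkhoff_source_def by (intro cring.axioms(1) cring_mpol_ring)
    then show "Idl\<^bsub>birkhoff_source n r\<^esub> (small_binomials n r :: (nat \<Rightarrow> nat, 'k) mpol set) \<subseteq> birkhoff_toric_ideal n r"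
      by (rule ring.genideal_minimal)
        (rule ideal_birkhoff_toric_ideal small_binomials_subset_toric_ideal)+
  qed
qed

end
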